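(* Let $F$ be a field of characteristic zero and let $E$ be a three-dimensional evolution algebra over $F$ with basis $\{e_1,e_2,e_3\}$ and table of multiplication $$e_1\cdot e_1=a_2e_2+a_3e_3,\quad e_2\cdot e_2=b_1e_1+b_3e_3,\quad e_3\cdot e_3=c_1e_1+c_2e_2,$$ and $e_i\cdot e_j=0$ for $i\ne j$, where $a_2a_3b_1b_3c_1c_2\neq0$. Then each of the basis elements $e_1,e_2,e_3$ has infinite period if and only if $$a_2^2b_1+a_3^2c_1=0,\qquad b_1^2a_2+b_3^2c_2=0,\qquad c_1^2a_3+c_2^2b_3=0.$$
   Context: An evolution algebra is an algebra with a basis $\{e_i\}$ such that $e_i\cdot e_j=0$ for $i\neq j$. Plenary powers of an element $x$ are defined by $x^{[1]}=x$, $x^{[k+1]}=x^{[k]}\cdot x^{[k]}$ for $k\ge1$. For a basis element $e_j$, write $e_j<x$ if $e_j$ occurs with nonzero coefficient in the expansion of $x$ in the given basis. The period of $e_j$ is defined as the greatest common divisor of $\{\log_2 m \mid e_j<e_j^{[m]}\}$; the period is infinite when $e_j$ never reoccurs, i.e. when for every $k\ge2$ the coefficient of $e_j$ in $e_j^{[k]}$ is zero. *)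

theory Defs
  imports Main "HOL-Library.Extended_Nat"
begin

text \<open>
  Plenary powers are indexed from 1: \<open>x\<^sup>[\<^sup>1\<^sup>] = x\<close>, and each further index squares the previous power.
  The value at index 0 is irrelevant (it is also \<open>x\<close>).
\<close>

definition plenary_power :: "('v \<Rightarrow> 'v \<Rightarrow> 'v) \<Rightarrow> 'v \<Rightarrow> nat \<Rightarrow> 'v" where
  "plenary_power mult x k = ((\<lambda>y. mult y y) ^^ (k - 1)) x"

lemma plenary_power_1: "plenary_power mult x 1 = x"
  by (simp add: plenary_power_def)

lemma plenary_power_Suc:
  assumes "k \<ge> 1"
  shows "plenary_power mult x (k + 1) = mult (plenary_power mult x k) (plenary_power mult x k)"
  using assms by (cases k) (simp_all add: plenary_power_def)

text \<open>
  An evolution algebra over a field, on the whole type \<open>'v\<close>, with a distinguished natural basis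
  \<open>B\<close>. No associativity is assumed.
\<close>

locale evolution_algebra = vector_space scale
  for scale :: "'a::field \<Rightarrow> 'v::ab_group_add \<Rightarrow> 'v" +
  fixes mult :: "'v \<Rightarrow> 'v \<Rightarrow> 'v"
    and B :: "'v set"
  assumes linear_mult_right: "\<And>x. Vector_Spaces.linear scale scale (\<lambda>y. mult x y)"
    and linear_mult_left: "\<And>y. Vector_Spaces.linear scale scale (\<lambda>x. mult x y)"
    and independent_basis: "independent B"
    and span_basis: "span B = UNIV"
    and mult_distinct: "\<And>x y. x \<in> B \<Longrightarrow> y \<in> B \<Longrightarrow> x \<noteq> y \<Longrightarrow> mult x y = 0"
begin

definition occurs_in :: "'v \<Rightarrow> 'v \<Rightarrow> bool" where
  "occurs_in b x \<longleftrightarrow> b \<in> B \<and> representation B x b \<noteq> 0"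

text \<open>
  The period of \<open>b\<close> is the gcd of the numbers \<open>log\<^sub>2 m\<close> such that \<open>b\<close> occurs in its plenary power of
  exponent \<open>m\<close>. The exponents of plenary powers are the powers of two: in the indexing above, the
  plenary power of index \<open>n + 1\<close> is an iterated product of \<open>m = 2\<^sup>n\<close> factors, so that
  \<open>log\<^sub>2 m = n\<close>. The trivial occurrence \<open>n = 0\<close> does not affect the gcd. If there is no other
  occurrence, the period is infinite (whereas \<open>Gcd {0} = 0\<close> in the library).
\<close>

definition period :: "'v \<Rightarrow> enat" where
  "period b =
    (if \<forall>k\<ge>2. representation B (plenary_power mult b k) b = 0 then \<infinity>
     else enat (Gcd {n. occurs_in b (plenary_power mult b (n + 1))}))"

end

end

theory Submission
  imports Defs
begin

text \<open>
  Suppose that the square of a basis element \<open>e\<close> is \<open>p f + q g\<close>, where \<open>f\<close> and \<open>g\<close> are the other two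
  basis elements, \<open>f f = r e + s g\<close> and \<open>g g = t e + u f\<close>. Squaring \<open>p f + q g\<close> gives
  \<open>e\<^sup>[\<^sup>3\<^sup>] = (p\<^sup>2 r + q\<^sup>2 t) e + q\<^sup>2 u f + p\<^sup>2 s g\<close>. Hence an infinite period of \<open>e\<close> forces
  \<open>p\<^sup>2 r + q\<^sup>2 t = 0\<close>, and doing this for each of the three basis elements gives the three equations.

  Conversely, the three equations together make the ratio of the two remaining coefficients of
  \<open>e\<^sup>[\<^sup>3\<^sup>]\<close> equal to that of \<open>e\<^sup>[\<^sup>2\<^sup>]\<close>, that is, \<open>p\<^sup>3 s = q\<^sup>3 u\<close> (lemma \<open>loop_equations_imp_ratio\<close>).
  So \<open>e\<^sup>[\<^sup>2\<^sup>]\<close> spans a line that is stable under squaring. All later plenary powers stay on this line,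
  which lies in the span of \<open>f\<close> and \<open>g\<close>, and \<open>e\<close> never reoccurs.

  The equations and the multiplication table are invariant under relabelling the basis, so it is
  enough to argue for one basis element.
\<close>

text \<open>
  The first equation gives \<open>p\<^sup>4 r\<^sup>2 = q\<^sup>4 t\<^sup>2\<close>. The other two replace \<open>p r\<^sup>2\<close> by \<open>- s\<^sup>2 u\<close> and \<open>q t\<^sup>2\<close> by
  \<open>- u\<^sup>2 s\<close>, after which \<open>s u\<close> cancels.
\<close>

lemma loop_equations_imp_ratio:
  fixes p q r s t u :: "'b::idom"
  assumes "p\<^sup>2 * r + q\<^sup>2 * t = 0" "r\<^sup>2 * p + s\<^sup>2 * u = 0" "t\<^sup>2 * q + u\<^sup>2 * s = 0"
    and "s \<noteq> 0" "u \<noteq> 0"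
  shows "p ^ 3 * s = q ^ 3 * u"
proof -
  have pr: "p\<^sup>2 * r = - (q\<^sup>2 * t)" and rp: "r\<^sup>2 * p = - (s\<^sup>2 * u)" and tq: "t\<^sup>2 * q = - (u\<^sup>2 * s)"
    using assms(1-3) by (simp_all add: eq_neg_iff_add_eq_0)
  have "p ^ 3 * (r\<^sup>2 * p) = (p\<^sup>2 * r)\<^sup>2"
    by algebra
  also have "\<dots> = q ^ 3 * (t\<^sup>2 * q)"
    unfolding pr by algebra
  finally have "(s * u) * (p ^ 3 * s) = (s * u) * (q ^ 3 * u)"
    unfolding rp tq by (simp add: power2_eq_square algebra_simps)
  then show ?thesis
    using assms(4,5) by simp
qed

context evolution_algebra
begin

lemma period_eq_infinity_iff:
  "period b = \<infinity> \<longleftrightarrow> (\<forall>k\<ge>2. representation B (plenary_power mult b k) b = 0)"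
  by (simp add: period_def)

lemmas mult_add_left = module_hom.add[OF Vector_Spaces.linear.axioms(3)[OF linear_mult_left]]
lemmas mult_add_right = module_hom.add[OF Vector_Spaces.linear.axioms(3)[OF linear_mult_right]]
lemmas mult_scale_left = module_hom.scale[OF Vector_Spaces.linear.axioms(3)[OF linear_mult_left]]
lemmas mult_scale_right = module_hom.scale[OF Vector_Spaces.linear.axioms(3)[OF linear_mult_right]]

lemma mult_scale_scale: "mult (scale c x) (scale d y) = scale (c * d) (mult x y)"
  by (simp add: mult_scale_left mult_scale_right mult.commute)

text \<open>
  Squaring is a quadratic map without mixed terms, because distinct basis elements annihilate
  each other.
\<close>

lemma square_of_two_basis_elements:
  assumes "f \<in> B" "g \<in> B" "f \<noteq> g"
  shows "mult (scale x f + scale y g) (scale x f + scale y g) =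
         scale (x\<^sup>2) (mult f f) + scale (y\<^sup>2) (mult g g)"
proof -
  have "mult (scale x f + scale y g) (scale x f + scale y g) =
        mult (scale x f) (scale x f) + mult (scale x f) (scale y g)
        + (mult (scale y g) (scale x f) + mult (scale y g) (scale y g))"
    by (simp only: mult_add_left mult_add_right add_ac)
  then show ?thesis
    using assms mult_distinct[of f g] mult_distinct[of g f]
    by (simp add: mult_scale_scale power2_eq_square)
qed

lemma representation_of_three_basis_elements:
  assumes "{e, f, g} \<subseteq> B" "distinct [e, f, g]"
  shows "representation B (scale x e + scale y f + scale z g) e = x"
  using assms
  by (simp add: representation_add representation_scale representation_basis
      independent_basis span_basis)

lemma plenary_power_square_eigenvector:
  assumes eigen: "mult (mult x x) (mult x x) = scale l (mult x x)" and "k \<ge> 2"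
  shows "\<exists>c. plenary_power mult x k = scale c (mult x x)"
  using \<open>k \<ge> 2\<close>
proof (induction k rule: nat_induct_at_least)
  case base
  have "plenary_power mult x 2 = scale 1 (mult x x)"
    by (simp add: plenary_power_def)
  then show ?case ..
next
  case (Suc k)
  then obtain c where "plenary_power mult x k = scale c (mult x x)"
    by blast
  then have "plenary_power mult x (Suc k) = scale (c * c * l) (mult x x)"
    using Suc.hyps plenary_power_Suc[of k mult x]
    by (simp add: mult_scale_scale eigen)
  then show ?case ..
qed

context
  fixes e f g :: 'v and p q r s t u :: 'a
  assumes basis: "{e, f, g} \<subseteq> B" "distinct [e, f, g]"
    and table: "mult e e = scale p f + scale q g"
      "mult f f = scale r e + scale s g"
      "mult g g = scale t e + scale u f"
begin

lemma third_plenary_power: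
  "mult (mult e e) (mult e e) =
   scale (p\<^sup>2 * r + q\<^sup>2 * t) e + scale (q\<^sup>2 * u) f + scale (p\<^sup>2 * s) g"
proof -
  have "mult (mult e e) (mult e e) = scale (p\<^sup>2) (mult f f) + scale (q\<^sup>2) (mult g g)"
    unfolding table(1) using basis by (intro square_of_two_basis_elements) auto
  then show ?thesis
    by (simp add: table(2,3) scale_right_distrib scale_left_distrib algebra_simps)
qed

lemma infinite_period_imp_loop_equation:
  assumes "period e = \<infinity>"
  shows "p\<^sup>2 * r + q\<^sup>2 * t = 0"
proof -
  have "plenary_power mult e 3 = mult (mult e e) (mult e e)"
    by (simp add: plenary_power_def numeral_2_eq_2)
  moreover have "representation B (plenary_power mult e 3) e = 0"
    using assms by (simp add: period_eq_infinity_iff)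
  ultimately show ?thesis
    using representation_of_three_basis_elements[OF basis]
    by (simp add: third_plenary_power)
qed

lemma loop_equations_imp_infinite_period:
  assumes eqs: "p\<^sup>2 * r + q\<^sup>2 * t = 0" "r\<^sup>2 * p + s\<^sup>2 * u = 0" "t\<^sup>2 * q + u\<^sup>2 * s = 0"
    and nz: "p \<noteq> 0" "s \<noteq> 0" "u \<noteq> 0"
  shows "period e = \<infinity>"
proof -
  \<comment> \<open>Comparing the coefficients of \<open>f\<close> in \<open>e\<^sup>[\<^sup>2\<^sup>]\<close> and \<open>e\<^sup>[\<^sup>3\<^sup>]\<close> gives the factor;
      \<open>p\<^sup>3 s = q\<^sup>3 u\<close> says that the coefficients of \<open>g\<close> have the same ratio.\<close>
  define l where "l = q\<^sup>2 * u / p"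
  have "p ^ 3 * s = q ^ 3 * u"
    using eqs nz by (intro loop_equations_imp_ratio)
  then have "p\<^sup>2 * s = l * q" "q\<^sup>2 * u = l * p"
    using nz(1) by (simp_all add: l_def field_simps power2_eq_square power3_eq_cube)
  then have eigen: "mult (mult e e) (mult e e) = scale l (mult e e)"
    unfolding third_plenary_power by (simp add: eqs(1) table(1) scale_right_distrib)
  have "representation B (plenary_power mult e k) e = 0" if "k \<ge> 2" for k
  proof -
    obtain c where "plenary_power mult e k = scale c (mult e e)"
      using plenary_power_square_eigenvector[OF eigen \<open>k \<ge> 2\<close>] by blast
    then have "plenary_power mult e k = scale 0 e + scale (c * p) f + scale (c * q) g"
      by (simp add: table(1) scale_right_distrib)
    then show ?thesis
      using representation_of_three_basis_elements[OF basis] by metis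
  qed
  then show ?thesis
    by (simp add: period_eq_infinity_iff)
qed

end

end

theorem theorem5p2:
  fixes scale :: "'a::field_char_0 \<Rightarrow> 'v::ab_group_add \<Rightarrow> 'v"
    and mult :: "'v \<Rightarrow> 'v \<Rightarrow> 'v"
    and e1 e2 e3 :: 'v
    and a2 a3 b1 b3 c1 c2 :: 'a
  assumes "evolution_algebra scale mult {e1, e2, e3}"
    and "distinct [e1, e2, e3]"
    and "mult e1 e1 = scale a2 e2 + scale a3 e3"
    and "mult e2 e2 = scale b1 e1 + scale b3 e3"
    and "mult e3 e3 = scale c1 e1 + scale c2 e2"
    and "a2 * a3 * b1 * b3 * c1 * c2 \<noteq> 0"
  shows "(evolution_algebra.period scale mult {e1, e2, e3} e1 = \<infinity> \<and>
          evolution_algebra.period scale mult {e1, e2, e3} e2 = \<infinity> \<and>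
          evolution_algebra.period scale mult {e1, e2, e3} e3 = \<infinity>) \<longleftrightarrow>
         (a2\<^sup>2 * b1 + a3\<^sup>2 * c1 = 0 \<and>
          b1\<^sup>2 * a2 + b3\<^sup>2 * c2 = 0 \<and>
          c1\<^sup>2 * a3 + c2\<^sup>2 * b3 = 0)"
proof -
  interpret evolution_algebra scale mult "{e1, e2, e3}"
    by (fact assms(1))
  have nz: "a2 \<noteq> 0" "a3 \<noteq> 0" "b1 \<noteq> 0" "b3 \<noteq> 0" "c1 \<noteq> 0" "c2 \<noteq> 0"
    using assms(6) by auto
  \<comment> \<open>The three relabellings of the table, each with a different basis element in first place.\<close>
  have basis1: "{e1, e2, e3} \<subseteq> {e1, e2, e3}" "distinct [e1, e2, e3]"
    and basis2: "{e2, e1, e3} \<subseteq> {e1, e2, e3}" "distinct [e2, e1, e3]"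
    and basis3: "{e3, e1, e2} \<subseteq> {e1, e2, e3}" "distinct [e3, e1, e2]"
    using assms(2) by auto
  have sq1: "mult e1 e1 = scale a3 e3 + scale a2 e2"
    and sq2: "mult e2 e2 = scale b3 e3 + scale b1 e1"
    and sq3: "mult e3 e3 = scale c2 e2 + scale c1 e1"
    using assms(3-5) by (simp_all add: add.commute)
  note table1 = basis1 assms(3) assms(4) assms(5)
  note table2 = basis2 assms(4) assms(3) sq3
  note table3 = basis3 assms(5) sq1 sq2
  show ?thesis
  proof (intro iffI conjI; elim conjE)
    show "a2\<^sup>2 * b1 + a3\<^sup>2 * c1 = 0" if "period e1 = \<infinity>"
      using infinite_period_imp_loop_equation[OF table1 that] .
    show "b1\<^sup>2 * a2 + b3\<^sup>2 * c2 = 0" if "period e2 = \<infinity>"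
      using infinite_period_imp_loop_equation[OF table2 that] .
    show "c1\<^sup>2 * a3 + c2\<^sup>2 * b3 = 0" if "period e3 = \<infinity>"
      using infinite_period_imp_loop_equation[OF table3 that] .
  next
    assume eqs: "a2\<^sup>2 * b1 + a3\<^sup>2 * c1 = 0" "b1\<^sup>2 * a2 + b3\<^sup>2 * c2 = 0" "c1\<^sup>2 * a3 + c2\<^sup>2 * b3 = 0"
    show "period e1 = \<infinity>"
      using loop_equations_imp_infinite_period[OF table1] eqs nz by simp
    show "period e2 = \<infinity>"
      using loop_equations_imp_infinite_period[OF table2] eqs nz by (simp add: add.commute)
    show "period e3 = \<infinity>"
      using loop_equations_imp_infinite_period[OF table3] eqs nz by (simp add: add.commute)
  qed
qed

end
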